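(* Let $0<s<1$. (i) The map $$\mathscr{X}_s(\mathbb{C})\ni\varphi(z)\ \mapsto\ \sqrt{\frac{s}{1-s^2}}\;\varphi\left(\sqrt{\frac{s}{1-s^2}}\,z\right)\exp\left(\frac14\,\frac{1+s^2}{1-s^2}\,z^2\right)\in\mathscr{H}_B(\mathbb{C})$$ is a Hilbert space isomorphism (a bijective linear map preserving inner products) of $\mathscr{X}_s(\mathbb{C})$ onto $\mathscr{H}_B(\mathbb{C})$, and its inverse is given by $$\mathscr{H}_B(\mathbb{C})\ni\psi(z)\ \mapsto\ \sqrt{\frac{1-s^2}{s}}\;\psi\left(\sqrt{\frac{1-s^2}{s}}\,z\right)\exp\left(-\frac{1+s^2}{4s}\,z^2\right)\in\mathscr{X}_s(\mathbb{C}).$$ (ii) For every $n=0,1,2,\dotsc$ and every $z\in\mathbb{C}$, $$\psi^s_n(z)\,\exp\left(-\frac{1-s^2}{4s}|z|^2+\frac{1+s^2}{4s}z^2\right)=\left(-\sqrt{\frac{1-s^2}{s}}\right)^n b_{nn}(s)^{-1/2}\,\Psi^{\sqrt{s},0}_n\left(\sqrt{\frac{1-s^2}{s}}\,z\right)\exp\left(-\frac14\left|\sqrt{\frac{1-s^2}{s}}\,z\right|^2\right).$$ (iii) The reproducing kernel of $\mathscr{X}_s(\mathbb{C})$ is obtained from the isomorphism in (i) and the reproducing formula of $\mathscr{H}_B(\mathbb{C})$. That is, transporting the reproducing kernel $\frac{1}{2\pi}e^{z\bar\zeta/2}$ of $\mathscr{H}_B(\mathbb{C})$ by the isomorphism gives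 $$K_s(z,\zeta)=\frac{1-s^2}{2\pi s}\exp\left(\frac{1-s^2}{2s}z\bar\zeta-\frac{1+s^2}{4s}(z^2+\bar\zeta^2)\right),$$ and for all $\varphi\in\mathscr{X}_s(\mathbb{C})$ and $z\in\mathbb{C}$, $$\varphi(z)=\int_{\mathbb{C}}K_s(z,\zeta)\,\varphi(\zeta)\exp\left(-\frac{1-s^2}{2s}|\zeta|^2+\frac{1+s^2}{4s}(\zeta^2+\bar\zeta^2)\right)L(d\zeta).$$
   Context: $L(dz)$ is Lebesgue measure on $\mathbb{C}\simeq\mathbb{R}^2$. For $0<s<1$, $\mathscr{X}_s(\mathbb{C})$ is the Hilbert space of all holomorphic functions $\varphi$ on $\mathbb{C}$ with $$\|\varphi\|_s^2=\int_{\mathbb{C}}|\varphi(z)|^2\exp\left(-\frac{1-s^2}{2s}|z|^2+\frac{1+s^2}{4s}(z^2+\bar z^2)\right)L(dz)<\infty,$$ with inner product $(\varphi,\psi)_s=\int_{\mathbb{C}}\varphi(z)\overline{\psi(z)}\exp\left(-\frac{1-s^2}{2s}|z|^2+\frac{1+s^2}{4s}(z^2+\bar z^2)\right)L(dz)$. $\mathscr{H}_B(\mathbb{C})$ (the standard Segal-Bargmann space) is the Hilbert space of all holomorphic functions on $\mathbb{C}$ that are square integrable with respect to $e^{-|z|^2/2}L(dz)$, with inner product $(\varphi,\psi)_{\mathscr{H}_B}=\int_{\mathbb{C}}\varphi(z)\overline{\psi(z)}e^{-|z|^2/2}L(dz)$. Its reproducing formula is $\varphi(z)=\frac{1}{2\pi}\int_{\mathbb{C}}e^{z\bar\zeta/2}\varphi(\zeta)e^{-|\zeta|^2/2}L(d\zeta)$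 for $\varphi\in\mathscr{H}_B(\mathbb{C})$. Holomorphic Hermite functions: for $n=0,1,2,\dotsc$, $$H_n(z)=(-1)^ne^{z^2}\left(\frac{d}{dz}\right)^ne^{-z^2},\qquad b_{nn}(s)=\frac{\pi\sqrt{s}}{1-s}\,2^n\left(\frac{1+s}{1-s}\right)^n n!,\qquad \psi^s_n(z)=b_{nn}(s)^{-1/2}e^{-z^2/2}H_n(z).$$ For $\alpha>0$, $\beta\in\mathbb{R}$ with $(\alpha,\beta)\neq(1,0)$, put $$\mu=\frac{1-\alpha^2-\beta^2+2i\beta}{1+\alpha^2+\beta^2},\qquad \lambda=\frac{2\alpha^2}{(1+\alpha^2+\beta^2)(1-\alpha^2-\beta^2-2i\beta)},$$ $$\Psi^{\alpha,\beta}_0(z)=\exp\left(\frac{\mu}{4}z^2\right),\qquad \Psi^{\alpha,\beta}_n(z)=\left\{e^{\lambda z^2/2}\left(\frac{d}{dz}\right)^ne^{-\lambda z^2/2}\right\}\Psi^{\alpha,\beta}_0(z)\quad(n\geq1),$$ where the braces denote a function (the derivative acts only on $e^{-\lambda z^2/2}$) multiplied by $\Psi^{\alpha,\beta}_0(z)$. The functions $\Psi^{\alpha,\beta}_n$ are those associated with the ellipses $\{x+i\xi:(x,\xi)\in\mathbb{R}^2,\ |\alpha x+i(\beta x+\xi)|=\rho\}$, $\rho>0$; for $(\alpha,\beta)=(\sqrt{s},0)$ these are the ellipses $sx^2+\xi^2=\rho^2$. *)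

theory Defs
  imports "HOL-Complex_Analysis.Complex_Analysis"
begin

definition holo_L2 :: "(complex \<Rightarrow> real) \<Rightarrow> (complex \<Rightarrow> complex) set" where
  "holo_L2 w = {\<phi>. \<phi> holomorphic_on UNIV \<and> integrable lborel (\<lambda>z. (cmod (\<phi> z))\<^sup>2 * w z)}"

definition weighted_inner ::
    "(complex \<Rightarrow> real) \<Rightarrow> (complex \<Rightarrow> complex) \<Rightarrow> (complex \<Rightarrow> complex) \<Rightarrow> complex" where
  "weighted_inner w \<phi> \<psi> = (\<integral>z. \<phi> z * cnj (\<psi> z) * complex_of_real (w z) \<partial>lborel)"

(* The number z^2 + cnj z^2 is real; Re only changes its type. *)
definition X_weight :: "real \<Rightarrow> complex \<Rightarrow> real" where
  "X_weight s z =
     exp (- ((1 - s\<^sup>2) / (2 * s)) * (cmod z)\<^sup>2 + (1 + s\<^sup>2) / (4 * s) * Re (z\<^sup>2 + (cnj z)\<^sup>2))"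

definition X_space :: "real \<Rightarrow> (complex \<Rightarrow> complex) set" where
  "X_space s = holo_L2 (X_weight s)"

definition X_inner :: "real \<Rightarrow> (complex \<Rightarrow> complex) \<Rightarrow> (complex \<Rightarrow> complex) \<Rightarrow> complex" where
  "X_inner s = weighted_inner (X_weight s)"

definition HB_weight :: "complex \<Rightarrow> real" where
  "HB_weight z = exp (- (cmod z)\<^sup>2 / 2)"

definition HB_space :: "(complex \<Rightarrow> complex) set" where
  "HB_space = holo_L2 HB_weight"

definition HB_inner :: "(complex \<Rightarrow> complex) \<Rightarrow> (complex \<Rightarrow> complex) \<Rightarrow> complex" where
  "HB_inner = weighted_inner HB_weight"

definition function_subspace :: "(complex \<Rightarrow> complex) set \<Rightarrow> bool" where
  "function_subspace V \<longleftrightarrow>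
     (\<lambda>z. 0) \<in> V \<and> (\<forall>f\<in>V. \<forall>g\<in>V. \<forall>a b. (\<lambda>z. a * f z + b * g z) \<in> V)"

definition hilbert_isomorphism ::
    "(complex \<Rightarrow> complex) set \<Rightarrow> ((complex \<Rightarrow> complex) \<Rightarrow> (complex \<Rightarrow> complex) \<Rightarrow> complex) \<Rightarrow>
     (complex \<Rightarrow> complex) set \<Rightarrow> ((complex \<Rightarrow> complex) \<Rightarrow> (complex \<Rightarrow> complex) \<Rightarrow> complex) \<Rightarrow>
     ((complex \<Rightarrow> complex) \<Rightarrow> (complex \<Rightarrow> complex)) \<Rightarrow> bool" where
  "hilbert_isomorphism V ipV W ipW T \<longleftrightarrow>
     function_subspace V \<and> function_subspace W \<and>
     bij_betw T V W \<and>
     (\<forall>f\<in>V. \<forall>g\<in>V. \<forall>a b. T (\<lambda>z. a * f z + b * g z) = (\<lambda>z. a * T f z + b * T g z)) \<and>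
     (\<forall>f\<in>V. \<forall>g\<in>V. ipW (T f) (T g) = ipV f g)"

definition X_to_HB :: "real \<Rightarrow> (complex \<Rightarrow> complex) \<Rightarrow> complex \<Rightarrow> complex" where
  "X_to_HB s \<phi> = (\<lambda>z.
     complex_of_real (sqrt (s / (1 - s\<^sup>2))) * \<phi> (complex_of_real (sqrt (s / (1 - s\<^sup>2))) * z)
       * exp (complex_of_real (1 / 4 * ((1 + s\<^sup>2) / (1 - s\<^sup>2))) * z\<^sup>2))"

definition HB_to_X :: "real \<Rightarrow> (complex \<Rightarrow> complex) \<Rightarrow> complex \<Rightarrow> complex" where
  "HB_to_X s \<psi> = (\<lambda>z.
     complex_of_real (sqrt ((1 - s\<^sup>2) / s)) * \<psi> (complex_of_real (sqrt ((1 - s\<^sup>2) / s)) * z)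
       * exp (- complex_of_real ((1 + s\<^sup>2) / (4 * s)) * z\<^sup>2))"

definition hermite :: "nat \<Rightarrow> complex \<Rightarrow> complex" where
  "hermite n z = (-1) ^ n * exp (z\<^sup>2) * (deriv ^^ n) (\<lambda>w. exp (- w\<^sup>2)) z"

definition b_coeff :: "nat \<Rightarrow> real \<Rightarrow> real" where
  "b_coeff n s = pi * sqrt s / (1 - s) * 2 ^ n * ((1 + s) / (1 - s)) ^ n * fact n"

definition psi_fun :: "real \<Rightarrow> nat \<Rightarrow> complex \<Rightarrow> complex" where
  "psi_fun s n z = complex_of_real (b_coeff n s powr (- 1 / 2)) * exp (- z\<^sup>2 / 2) * hermite n z"

definition mu_coeff :: "real \<Rightarrow> real \<Rightarrow> complex" where
  "mu_coeff \<alpha> \<beta> =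
     (complex_of_real (1 - \<alpha>\<^sup>2 - \<beta>\<^sup>2) + 2 * \<i> * complex_of_real \<beta>) / complex_of_real (1 + \<alpha>\<^sup>2 + \<beta>\<^sup>2)"

definition lambda_coeff :: "real \<Rightarrow> real \<Rightarrow> complex" where
  "lambda_coeff \<alpha> \<beta> = complex_of_real (2 * \<alpha>\<^sup>2) /
     (complex_of_real (1 + \<alpha>\<^sup>2 + \<beta>\<^sup>2) *
      (complex_of_real (1 - \<alpha>\<^sup>2 - \<beta>\<^sup>2) - 2 * \<i> * complex_of_real \<beta>))"

definition Psi_zero :: "real \<Rightarrow> real \<Rightarrow> complex \<Rightarrow> complex" where
  "Psi_zero \<alpha> \<beta> z = exp (mu_coeff \<alpha> \<beta> / 4 * z\<^sup>2)"

(* Intended for \<alpha> > 0 and (\<alpha>, \<beta>) \<noteq> (1, 0): at (1, 0) the denominator of lambda_coeff vanishes. *)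
definition Psi_fun :: "real \<Rightarrow> real \<Rightarrow> nat \<Rightarrow> complex \<Rightarrow> complex" where
  "Psi_fun \<alpha> \<beta> n z =
     (if n = 0 then Psi_zero \<alpha> \<beta> z
      else (exp (lambda_coeff \<alpha> \<beta> * z\<^sup>2 / 2) *
            (deriv ^^ n) (\<lambda>w. exp (- lambda_coeff \<alpha> \<beta> * w\<^sup>2 / 2)) z) * Psi_zero \<alpha> \<beta> z)"

definition HB_kernel :: "complex \<Rightarrow> complex \<Rightarrow> complex" where
  "HB_kernel z \<zeta> = complex_of_real (1 / (2 * pi)) * exp (z * cnj \<zeta> / 2)"

definition X_kernel :: "real \<Rightarrow> complex \<Rightarrow> complex \<Rightarrow> complex" where
  "X_kernel s z \<zeta> = complex_of_real ((1 - s\<^sup>2) / (2 * pi * s)) *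
     exp (complex_of_real ((1 - s\<^sup>2) / (2 * s)) * z * cnj \<zeta>
          - complex_of_real ((1 + s\<^sup>2) / (4 * s)) * (z\<^sup>2 + (cnj \<zeta>)\<^sup>2))"

(* A kernel is linear in its first and antilinear in its second variable: if
   K(z,\<zeta>) = \<Sum>n. e_n(z) * cnj (e_n(\<zeta>)), its transport along a unitary operator T is
   \<Sum>n. (T e_n)(z) * cnj ((T e_n)(\<zeta>)). So T acts on z, and cnj o T o cnj acts on \<zeta>. *)
definition transport_kernel ::
    "((complex \<Rightarrow> complex) \<Rightarrow> (complex \<Rightarrow> complex)) \<Rightarrow>
     (complex \<Rightarrow> complex \<Rightarrow> complex) \<Rightarrow> complex \<Rightarrow> complex \<Rightarrow> complex" where
  "transport_kernel T K = (\<lambda>z \<zeta>. T (\<lambda>z'. cnj (T (\<lambda>\<zeta>'. cnj (K z' \<zeta>')) \<zeta>)) z)"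

definition is_reproducing_kernel ::
    "(complex \<Rightarrow> complex) set \<Rightarrow> ((complex \<Rightarrow> complex) \<Rightarrow> (complex \<Rightarrow> complex) \<Rightarrow> complex) \<Rightarrow>
     (complex \<Rightarrow> complex \<Rightarrow> complex) \<Rightarrow> bool" where
  "is_reproducing_kernel V ip K \<longleftrightarrow>
     (\<forall>z. (\<lambda>w. K w z) \<in> V) \<and> (\<forall>\<phi>\<in>V. \<forall>z. \<phi> z = ip \<phi> (\<lambda>w. K w z))"

end

theory Submission
  imports Defs "HOL-Probability.Distributions"
begin

text \<open>
  Substituting \<open>z \<mapsto> c z\<close> with \<open>c = sqrt (s / (1 - s\<^sup>2))\<close> turns \<^const>\<open>X_weight\<close> into the
  Gaussian weight times the squared modulus of the entire zero-free function
  \<open>E(z) = exp ((1 + s\<^sup>2) / (4 (1 - s\<^sup>2)) z\<^sup>2)\<close>: the part of the weight that involves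
  \<open>z\<^sup>2 + cnj z\<^sup>2 = 2 Re (z\<^sup>2)\<close> is the logarithm of such a modulus. Hence
  \<open>\<phi>(z) \<mapsto> c \<phi>(c z) E(z)\<close> preserves inner products, the factor \<open>c\<close> absorbing the Jacobian, and the
  inverse map has the same shape. The two lemmas \<open>holo_L2_rescale\<close> and \<open>weighted_inner_rescale\<close>
  state this for arbitrary weights.

  The reproducing kernel of the Segal-Bargmann space carries the analytic content. For an entire
  function \<open>f\<close> and a radial weight \<open>g\<close>, averaging the integral of \<open>f g\<close> over all rotations of the
  plane replaces \<open>f\<close> by its mean over circles, that is, by \<open>f 0\<close>
  (\<open>radial_weight_mean_value\<close>). With the Gaussian weight this is the
  reproducing formula at the point \<open>0\<close>. Translating the plane by \<open>z\<close> multiplies the Gaussian by the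
  squared modulus of the exponential of an affine function, one factor of which can be absorbed into
  \<open>f\<close>; the other one is the kernel. This gives the formula at every point (\<open>HB_reproducing\<close>).
  Every function \<open>X_kernel s \<cdot> \<zeta>\<close> is a multiple of the image of some function
  \<open>HB_kernel \<cdot> \<zeta>'\<close> (\<open>X_kernel_eq\<close>), so the reproducing property passes to the other space along
  the isomorphism.

  The identity between the Hermite functions is the chain rule for the \<open>n\<close>-th derivative under
  \<open>w \<mapsto> k w\<close>, \<open>k = sqrt ((1 - s\<^sup>2) / s)\<close>, because \<open>k\<^sup>2 \<lambda> = 2\<close> and \<open>k\<^sup>2 \<mu> = (1 - s)\<^sup>2 / s\<close> for the
  coefficients at \<open>(sqrt s, 0)\<close>.
\<close>

unbundle no fps_syntax

section \<open>Lebesgue measure on the complex plane\<close>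

text \<open>
  A measure is Lebesgue measure as soon as it gives boxes their volume, and an orthogonal map does
  not change the volume of the preimage of a box.
\<close>
lemma distr_lborel_orthogonal:
  fixes f :: "real^'n::{finite,wellorder} \<Rightarrow> real^'n::_"
  assumes "orthogonal_transformation f"
  shows "distr lborel borel f = lborel"
proof (rule lborel_eqI[symmetric])
  \<comment> \<open>The volume formula concerns images, so the preimage is taken as an image under the inverse.\<close>
  have inv: "orthogonal_transformation (inv f)"
    by (rule orthogonal_transformation_inv[OF assms])
  have [measurable]: "f \<in> borel_measurable borel"
    using orthogonal_transformation_linear[OF assms]
    by (intro borel_measurable_continuous_onI linear_continuous_on) (simp add: linear_conv_bounded_linear)
  fix l u :: "real^'n::_" assume le: "\<And>b. b \<in> Basis \<Longrightarrow> l \<bullet> b \<le> u \<bullet> b"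
  have pre: "f -` box l u = inv f ` box l u"
    by (rule bij_vimage_eq_inv_image[OF orthogonal_transformation_bij[OF assms]])
  have meas: "inv f ` box l u \<in> lmeasurable"
    by (intro measurable_orthogonal_image[OF inv] lmeasurable_box)
  have pre_borel: "f -` box l u \<in> sets borel"
    using measurable_sets[OF \<open>f \<in> borel_measurable borel\<close>, of "box l u"] by simp
  have "emeasure (distr lborel borel f) (box l u) = emeasure lborel (inv f ` box l u)"
    by (subst emeasure_distr) (simp_all add: pre)
  also have "\<dots> = emeasure lebesgue (inv f ` box l u)"
    using pre_borel by (simp add: pre emeasure_completion)
  also have "\<dots> = emeasure lebesgue (box l u)"
    using meas lmeasurable_box[of l u]
    by (simp add: emeasure_eq_measure2 measure_orthogonal_image[OF inv])
  also have "\<dots> = (\<Prod>b\<in>Basis. (u - l) \<bullet> b)"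
    using le by (simp add: emeasure_lborel_box)
  finally show "emeasure (distr lborel borel f) (box l u) = (\<Prod>b\<in>Basis. (u - l) \<bullet> b)" .
qed simp

text \<open>
  The volume of linear images is known on Cartesian powers of the reals; this identification
  makes it available in the complex plane.
\<close>
lemma distr_lborel_Complex:
  "distr lborel borel (\<lambda>v::real^2. Complex (v $ 1) (v $ 2)) = lborel"
proof (rule lborel_eqI[symmetric])
  have [measurable]: "(\<lambda>v::real^2. Complex (v $ 1) (v $ 2)) \<in> borel_measurable borel"
    unfolding complex_eq by (intro borel_measurable_continuous_onI continuous_intros)
  fix l u :: complex assume le: "\<And>b. b \<in> Basis \<Longrightarrow> l \<bullet> b \<le> u \<bullet> b"
  have pre: "(\<lambda>v::real^2. Complex (v $ 1) (v $ 2)) -` box l u =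
      box (vector [Re l, Im l]) (vector [Re u, Im u])"
    by (auto simp: in_box_complex_iff mem_box_cart forall_2)
  have "emeasure (distr lborel borel (\<lambda>v::real^2. Complex (v $ 1) (v $ 2))) (box l u)
      = (\<Prod>b\<in>Basis. ((vector [Re u, Im u] :: real^2) - vector [Re l, Im l]) \<bullet> b)"
    using le[of 1] le[of \<i>] by (subst emeasure_distr)
      (auto simp: pre emeasure_lborel_box_eq Basis_vec_def inner_axis forall_2 Basis_complex_def)
  also have "\<dots> = (\<Prod>b\<in>Basis. (u - l) \<bullet> b)"
    by (simp add: Basis_vec_def Basis_complex_def inner_axis sum_2 UNIV_2 axis_eq_axis mult.commute)
  finally show "emeasure (distr lborel borel (\<lambda>v::real^2. Complex (v $ 1) (v $ 2))) (box l u) =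
      (\<Prod>b\<in>Basis. (u - l) \<bullet> b)" .
qed simp

lemma distr_lborel_rotation:
  fixes u :: complex
  assumes "cmod u = 1"
  shows "distr lborel borel ((*) u) = lborel"
proof -
  define J where "J = (\<lambda>v::real^2. Complex (v $ 1) (v $ 2))"
  define R where "R = (\<lambda>v::real^2. vector [Re u * v $ 1 - Im u * v $ 2, Im u * v $ 1 + Re u * v $ 2] :: real^2)"
  have R: "orthogonal_transformation R"
  proof -
    have "linear R"
      by (auto simp: R_def linear_iff vec_eq_iff forall_2 algebra_simps)
    moreover have "norm (R v) = norm v" for v
    proof -
      have "norm (R v) = cmod (u * J v)"
        by (simp add: R_def J_def norm_vec_def L2_set_def sum_2 cmod_def add.commute)
      also have "\<dots> = norm v"
        by (simp add: norm_mult assms) (simp add: J_def norm_vec_def L2_set_def sum_2 cmod_def)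
      finally show ?thesis .
    qed
    ultimately show ?thesis by (simp add: orthogonal_transformation)
  qed
  have [measurable]: "J \<in> borel_measurable borel"
    unfolding J_def complex_eq by (intro borel_measurable_continuous_onI continuous_intros)
  have [measurable]: "R \<in> borel_measurable borel"
    using orthogonal_transformation_linear[OF R]
    by (intro borel_measurable_continuous_onI linear_continuous_on) (simp add: linear_conv_bounded_linear)
  have J: "distr lborel borel J = lborel"
    unfolding J_def by (rule distr_lborel_Complex)
  have "distr lborel borel ((*) u) = distr (distr lborel borel J) borel ((*) u)"
    by (simp add: J)
  also have "\<dots> = distr lborel borel ((*) u \<circ> J)"
    by (rule distr_distr) auto
  also have "(*) u \<circ> J = J \<circ> R"
    by (auto simp: J_def R_def fun_eq_iff complex_eq_iff)
  also have "distr lborel borel (J \<circ> R) = distr (distr lborel borel R) borel J"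
    by (rule distr_distr[symmetric]) auto
  also have "\<dots> = lborel"
    by (simp add: distr_lborel_orthogonal[OF R] J)
  finally show ?thesis .
qed

lemma lborel_integral_invariant:
  fixes F :: "'a::euclidean_space \<Rightarrow> 'b::{banach, second_countable_topology}"
  assumes "T \<in> borel_measurable borel" "distr lborel borel T = lborel" "integrable lborel F"
  shows "integrable lborel (\<lambda>z. F (T z))" "(\<integral>z. F (T z) \<partial>lborel) = (\<integral>z. F z \<partial>lborel)"
  using assms integrable_distr_eq[of T lborel borel F] integral_distr[of T lborel borel F]
  by (auto dest: borel_measurable_integrable)

lemma lborel_translate:
  fixes F :: "'a::euclidean_space \<Rightarrow> 'b::{banach, second_countable_topology}"
  assumes "integrable lborel F"
  shows "integrable lborel (\<lambda>z. F (a + z))" "(\<integral>z. F (a + z) \<partial>lborel) = (\<integral>z. F z \<partial>lborel)"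
  by (rule lborel_integral_invariant[OF _ lborel_distr_plus assms]; simp)+

text \<open>
  In the second part both sides are zero when the function is not integrable.
\<close>
lemma lborel_scale_complex:
  fixes F :: "complex \<Rightarrow> 'b::{banach, second_countable_topology}"
  assumes "c \<noteq> 0" and [measurable]: "F \<in> borel_measurable borel"
  shows "integrable lborel (\<lambda>z. F (of_real c * z)) \<longleftrightarrow> integrable lborel F"
    and "(\<integral>z. F z \<partial>lborel) = c\<^sup>2 *\<^sub>R (\<integral>z. F (of_real c * z) \<partial>lborel)"
proof -
  have eq: "lborel = density (distr lborel borel (\<lambda>z::complex. of_real c * z)) (\<lambda>_. ennreal (c\<^sup>2))"
    using lborel_affine[OF assms(1), of "0::complex"]
    by (simp add: scaleR_conv_of_real power_abs ennreal_power[symmetric] flip: ennreal_power)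
  show "integrable lborel (\<lambda>z. F (of_real c * z)) \<longleftrightarrow> integrable lborel F"
  proof -
    have "integrable lborel F \<longleftrightarrow> integrable lborel (\<lambda>z. c\<^sup>2 *\<^sub>R F (of_real c * z))"
      by (subst eq) (simp add: integrable_density integrable_distr_eq)
    also have "\<dots> \<longleftrightarrow> integrable lborel (\<lambda>z. F (of_real c * z))"
      using integrable_scaleR_right[of "inverse (c\<^sup>2)" lborel "\<lambda>z. c\<^sup>2 *\<^sub>R F (of_real c * z)"]
        assms(1) by auto
    finally show ?thesis by simp
  qed
  show "(\<integral>z. F z \<partial>lborel) = c\<^sup>2 *\<^sub>R (\<integral>z. F (of_real c * z) \<partial>lborel)"
    by (subst eq) (simp add: integral_density integral_distr)
qed

section \<open>Mean values against radial weights\<close>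

text \<open>
  Cauchy's formula at the centre of the unit circle, for the entire function \<open>w \<mapsto> f (w z)\<close>.
\<close>
lemma circle_mean_value:
  fixes f :: "complex \<Rightarrow> complex"
  assumes "f holomorphic_on UNIV"
  shows "((\<lambda>t. f (cis (2 * pi * t) * z)) has_integral f 0) {0..1}"
proof -
  define g where "g = (\<lambda>w. f (w * z))"
  have g: "g holomorphic_on UNIV"
    unfolding g_def by (intro holomorphic_on_compose_gen[OF _ assms, unfolded o_def] holomorphic_intros) auto
  have "((\<lambda>u. g u / (u - 0)) has_contour_integral (2 * of_real pi * \<i> * g 0)) (circlepath 0 1)"
    using g by (intro Cauchy_integral_circlepath)
      (auto intro: holomorphic_on_imp_continuous_on holomorphic_on_subset)
  then have "((\<lambda>t. 2 * of_real pi * \<i> * g (cis (2 * pi * t))) has_integral (2 * of_real pi * \<i> * g 0)) {0..1}"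
    unfolding has_contour_integral
    by (rule has_integral_eq[rotated])
      (simp only: vector_derivative_circlepath, simp add: circlepath cis_conv_exp mult_ac)
  then have "((\<lambda>t. (1 / (2 * pi * \<i>)) * (2 * of_real pi * \<i> * g (cis (2 * pi * t)))) has_integral
      (1 / (2 * pi * \<i>)) * (2 * of_real pi * \<i> * g 0)) {0..1}"
    by (rule has_integral_mult_right)
  then show ?thesis by (simp add: g_def)
qed

text \<open>
  For every rotation \<open>u\<close> the integral of \<open>f (u z) g (u z) = f (u z) g z\<close> has the same value.
  Averaging over \<open>u\<close> and exchanging the two integrals leaves the circle mean \<open>f 0\<close>. The
  exchange is legitimate since the absolute values have the same integral for every \<open>u\<close>, too.
\<close>
lemma radial_weight_mean_value:
  fixes f :: "complex \<Rightarrow> complex" and g :: "complex \<Rightarrow> real"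
  assumes f: "f holomorphic_on UNIV"
    and radial: "\<And>u z. cmod u = 1 \<Longrightarrow> g (u * z) = g z"
    and int: "integrable lborel (\<lambda>z. f z * of_real (g z))"
  shows "(\<integral>z. f z * of_real (g z) \<partial>lborel) = f 0 * of_real (\<integral>z. g z \<partial>lborel)"
proof -
  define F where "F = (\<lambda>z. f z * of_real (g z))"
  define h where "h = (\<lambda>(t::real, z). indicator {0..1} t *\<^sub>R F (cis (2 * pi * t) * z))"
  have cont: "continuous_on UNIV f"
    using f by (rule holomorphic_on_imp_continuous_on)
  have F_meas [measurable]: "F \<in> borel_measurable borel"
    using borel_measurable_integrable[OF int] by (simp add: F_def)
  have rot: "integrable lborel (\<lambda>z. G (u * z))" "(\<integral>z. G (u * z) \<partial>lborel) = (\<integral>z. G z \<partial>lborel)"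
    if "cmod u = 1" "integrable lborel G" for u and G :: "complex \<Rightarrow> 'b::{banach, second_countable_topology}"
    by (rule lborel_integral_invariant[OF _ distr_lborel_rotation[OF that(1)] that(2)]; simp)+
  have "(\<lambda>p::real \<times> complex. F (cis (2 * pi * fst p) * snd p)) \<in> borel_measurable borel"
    by (rule measurable_compose[OF _ F_meas])
      (intro borel_measurable_continuous_onI continuous_intros)
  then have [measurable]:
      "(\<lambda>p::real \<times> complex. F (cis (2 * pi * fst p) * snd p)) \<in> borel_measurable (borel \<Otimes>\<^sub>M borel)"
    by (simp add: borel_prod)
  have h_meas: "h \<in> borel_measurable (lborel \<Otimes>\<^sub>M lborel)"
    unfolding h_def case_prod_beta by measurable
  have F_int: "integrable lborel F" using int by (simp add: F_def)
  have h_int: "integrable (lborel \<Otimes>\<^sub>M lborel) h"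
  proof (rule lborel_pair.Fubini_integrable[OF h_meas])
    have "(\<lambda>t. \<integral>z. norm (h (t, z)) \<partial>lborel) =
        (\<lambda>t. indicator {0..1} t *\<^sub>R (\<integral>z. norm (F z) \<partial>lborel))"
      using rot(2)[OF norm_cis integrable_norm[OF F_int]] by (simp add: h_def fun_eq_iff)
    then show "integrable lborel (\<lambda>t. \<integral>z. norm (h (t, z)) \<partial>lborel)"
      by simp
    show "AE t in lborel. integrable lborel (\<lambda>z. h (t, z))"
      using rot(1)[OF norm_cis F_int] by (simp add: h_def)
  qed
  have "(\<integral>t. (\<integral>z. h (t, z) \<partial>lborel) \<partial>lborel) = (\<integral>z. (\<integral>t. h (t, z) \<partial>lborel) \<partial>lborel)"
    using h_int by (intro lborel_pair.Fubini_integral[symmetric]) simp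
  moreover have "(\<integral>t. (\<integral>z. h (t, z) \<partial>lborel) \<partial>lborel) = (\<integral>z. F z \<partial>lborel)"
  proof -
    have "(\<lambda>t. \<integral>z. h (t, z) \<partial>lborel) = (\<lambda>t. indicator {0..1} t *\<^sub>R (\<integral>z. F z \<partial>lborel))"
      using rot(2)[OF norm_cis F_int] by (simp add: h_def fun_eq_iff)
    then show ?thesis by simp
  qed
  moreover have "(\<integral>t. h (t, z) \<partial>lborel) = f 0 * of_real (g z)" for z
  proof -
    have "set_integrable lborel {0..1} (\<lambda>t. f (cis (2 * pi * t) * z))"
      unfolding set_integrable_def
      by (intro borel_integrable_compact continuous_on_compose2[OF cont] continuous_intros) auto
    then have "(LINT t:{0..1}|lborel. f (cis (2 * pi * t) * z)) = f 0"
      using set_borel_integral_eq_integral(2) integral_unique[OF circle_mean_value[OF f]] by metis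
    moreover have "h (t, z) = (indicator {0..1} t *\<^sub>R f (cis (2 * pi * t) * z)) * of_real (g z)" for t
      by (simp add: h_def F_def radial)
    ultimately show ?thesis by (simp add: set_lebesgue_integral_def del: mult_scaleR_left)
  qed
  ultimately show ?thesis by (simp add: F_def)
qed

section \<open>Weighted spaces of entire functions\<close>

lemma holomorphic_borel_measurable:
  "f holomorphic_on UNIV \<Longrightarrow> f \<in> borel_measurable borel"
  by (intro borel_measurable_continuous_onI holomorphic_on_imp_continuous_on)

lemma cnj_borel_measurable [measurable]: "cnj \<in> borel_measurable borel"
  by (intro borel_measurable_continuous_onI continuous_intros)

lemma holo_L2_integrable_product:
  assumes [measurable]: "w \<in> borel_measurable borel" and nn: "\<And>z. 0 \<le> w z"
    and f: "f \<in> holo_L2 w" and g: "g \<in> holo_L2 w"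
  shows "integrable lborel (\<lambda>z. f z * cnj (g z) * of_real (w z))"
proof (rule Bochner_Integration.integrable_bound)
  show "integrable lborel (\<lambda>z. (cmod (f z))\<^sup>2 * w z + (cmod (g z))\<^sup>2 * w z)"
    using f g by (simp add: holo_L2_def)
  have [measurable]: "f \<in> borel_measurable borel" "g \<in> borel_measurable borel"
    using f g by (auto simp: holo_L2_def intro: holomorphic_borel_measurable)
  show "(\<lambda>z. f z * cnj (g z) * of_real (w z)) \<in> borel_measurable lborel"
    by measurable
  have "cmod (f z) * cmod (g z) \<le> (cmod (f z))\<^sup>2 + (cmod (g z))\<^sup>2" for z
    using sum_squares_bound[of "cmod (f z)" "cmod (g z)"] 
      mult_nonneg_nonneg[OF norm_ge_zero[of "f z"] norm_ge_zero[of "g z"]] by linarith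
  then show "AE z in lborel. norm (f z * cnj (g z) * of_real (w z))
      \<le> norm ((cmod (f z))\<^sup>2 * w z + (cmod (g z))\<^sup>2 * w z)"
    using nn by (auto simp: norm_mult simp flip: distrib_right intro!: mult_right_mono)
qed

lemma function_subspace_holo_L2:
  assumes [measurable]: "w \<in> borel_measurable borel" and nn: "\<And>z. 0 \<le> w z"
  shows "function_subspace (holo_L2 w)"
  unfolding function_subspace_def
proof (intro conjI ballI allI)
  show "(\<lambda>z. 0) \<in> holo_L2 w" by (simp add: holo_L2_def)
  fix f g a b assume f: "f \<in> holo_L2 w" and g: "g \<in> holo_L2 w"
  have [measurable]: "f \<in> borel_measurable borel" "g \<in> borel_measurable borel"
    using f g by (auto simp: holo_L2_def intro: holomorphic_borel_measurable)
  have bound: "(cmod (a * f z + b * g z))\<^sup>2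
      \<le> 2 * (cmod a)\<^sup>2 * (cmod (f z))\<^sup>2 + 2 * (cmod b)\<^sup>2 * (cmod (g z))\<^sup>2" for z
  proof -
    have "(cmod (a * f z + b * g z))\<^sup>2 \<le> (cmod a * cmod (f z) + cmod b * cmod (g z))\<^sup>2"
      by (intro power_mono order_trans[OF norm_triangle_ineq]) (simp_all add: norm_mult)
    also have "\<dots> \<le> 2 * (cmod a * cmod (f z))\<^sup>2 + 2 * (cmod b * cmod (g z))\<^sup>2"
      using sum_squares_bound[of "cmod a * cmod (f z)" "cmod b * cmod (g z)"]
      by (simp add: power2_sum)
    finally show ?thesis by (simp add: power_mult_distrib)
  qed
  have "integrable lborel (\<lambda>z. (cmod (a * f z + b * g z))\<^sup>2 * w z)"
  proof (rule Bochner_Integration.integrable_bound)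
    show "integrable lborel (\<lambda>z. 2 * (cmod a)\<^sup>2 * ((cmod (f z))\<^sup>2 * w z)
        + 2 * (cmod b)\<^sup>2 * ((cmod (g z))\<^sup>2 * w z))"
      using f g by (simp add: holo_L2_def)
    show "AE z in lborel. norm ((cmod (a * f z + b * g z))\<^sup>2 * w z)
        \<le> norm (2 * (cmod a)\<^sup>2 * ((cmod (f z))\<^sup>2 * w z) + 2 * (cmod b)\<^sup>2 * ((cmod (g z))\<^sup>2 * w z))"
      using nn mult_right_mono[OF bound nn] by (simp add: algebra_simps)
  qed measurable
  then show "(\<lambda>z. a * f z + b * g z) \<in> holo_L2 w"
    using f g by (auto simp: holo_L2_def intro!: holomorphic_intros)
qed

text \<open>
  Dilation by \<open>c\<close> followed by multiplication with \<open>E\<close>: the condition on the weights says that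
  squared moduli against \<open>w'\<close> become squared moduli against \<open>w\<close> at the dilated point.
\<close>
lemma holo_L2_rescale:
  fixes c :: real
  assumes "c \<noteq> 0" and E: "E holomorphic_on UNIV"
    and [measurable]: "w \<in> borel_measurable borel"
    and weights: "\<And>z. (cmod (E z))\<^sup>2 * w' z = w (of_real c * z)"
    and \<phi>: "\<phi> \<in> holo_L2 w"
  shows "(\<lambda>z. of_real c * \<phi> (of_real c * z) * E z) \<in> holo_L2 w'"
proof -
  have hol: "\<phi> holomorphic_on UNIV" using \<phi> by (simp add: holo_L2_def)
  then have [measurable]: "\<phi> \<in> borel_measurable borel" by (rule holomorphic_borel_measurable)
  have "(cmod (of_real c * \<phi> (of_real c * z) * E z))\<^sup>2 * w' z
      = c\<^sup>2 * ((cmod (\<phi> (of_real c * z)))\<^sup>2 * w (of_real c * z))" for z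
    unfolding weights[symmetric] by (simp add: norm_mult power_mult_distrib)
  moreover have "integrable lborel (\<lambda>z. (cmod (\<phi> (of_real c * z)))\<^sup>2 * w (of_real c * z))"
    using lborel_scale_complex(1)[OF \<open>c \<noteq> 0\<close>, of "\<lambda>z. (cmod (\<phi> z))\<^sup>2 * w z"] \<phi>
    by (simp add: holo_L2_def)
  moreover have "(\<lambda>z. of_real c * \<phi> (of_real c * z) * E z) holomorphic_on UNIV"
    by (intro holomorphic_intros E holomorphic_on_compose_gen[OF _ hol, unfolded o_def]) auto
  ultimately show ?thesis by (simp add: holo_L2_def)
qed

text \<open>
  The two prefactors \<open>c\<close> together are the Jacobian of the dilation of the plane.
\<close>
lemma weighted_inner_rescale:
  fixes c :: real
  assumes "c \<noteq> 0"
    and [measurable]: "w \<in> borel_measurable borel"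
    and weights: "\<And>z. (cmod (E z))\<^sup>2 * w' z = w (of_real c * z)"
    and \<phi>: "\<phi> holomorphic_on UNIV" and \<psi>: "\<psi> holomorphic_on UNIV"
  shows "weighted_inner w' (\<lambda>z. of_real c * \<phi> (of_real c * z) * E z)
      (\<lambda>z. of_real c * \<psi> (of_real c * z) * E z) = weighted_inner w \<phi> \<psi>"
proof -
  have [measurable]: "\<phi> \<in> borel_measurable borel" "\<psi> \<in> borel_measurable borel"
    using \<phi> \<psi> by (auto intro: holomorphic_borel_measurable)
  have "E z * cnj (E z) * of_real (w' z) = of_real (w (of_real c * z))" for z
    by (simp flip: complex_norm_square weights)
  then have "(of_real c * \<phi> (of_real c * z) * E z) * cnj (of_real c * \<psi> (of_real c * z) * E z) * of_real (w' z)
      = c\<^sup>2 *\<^sub>R (\<phi> (of_real c * z) * cnj (\<psi> (of_real c * z)) * of_real (w (of_real c * z)))" for z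
    by (simp add: scaleR_conv_of_real power2_eq_square mult_ac)
  moreover have "(\<lambda>z. \<phi> z * cnj (\<psi> z) * of_real (w z)) \<in> borel_measurable borel"
    by measurable
  ultimately show ?thesis
    unfolding weighted_inner_def
    using lborel_scale_complex(2)[OF \<open>c \<noteq> 0\<close>, of "\<lambda>z. \<phi> z * cnj (\<psi> z) * of_real (w z)"] by simp
qed

section \<open>Gaussian weights and the Segal-Bargmann space\<close>

lemma HB_weight_measurable [measurable]: "HB_weight \<in> borel_measurable borel"
  unfolding HB_weight_def by measurable

lemma X_weight_measurable [measurable]: "X_weight s \<in> borel_measurable borel"
  unfolding X_weight_def by measurable

lemma X_weight_nonneg: "0 \<le> X_weight s z" by (simp add: X_weight_def)

lemma HB_weight_nonneg: "0 \<le> HB_weight z" by (simp add: HB_weight_def)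

text \<open>
  The weight is the product of two one-dimensional Gaussians, each of total mass \<open>sqrt (2 \<pi>)\<close>.
\<close>
lemma gaussian_integral_complex:
  "integrable lborel HB_weight" "(\<integral>z. HB_weight z \<partial>lborel) = 2 * pi"
proof -
  have one: "(\<integral>\<^sup>+x. ennreal (exp (- x\<^sup>2 / 2)) \<partial>lborel) = ennreal (sqrt (2 * pi))"
  proof -
    have eq: "(\<lambda>x. exp (- x\<^sup>2 / 2)) = (\<lambda>x. sqrt (2 * pi) * std_normal_density x)"
      by (simp add: std_normal_density_def)
    have "(\<integral>\<^sup>+x. ennreal (sqrt (2 * pi) * std_normal_density x) \<partial>lborel)
        = ennreal (\<integral>x. sqrt (2 * pi) * std_normal_density x \<partial>lborel)"
      by (intro nn_integral_eq_integral) auto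
    then have "(\<integral>\<^sup>+x. ennreal (sqrt (2 * pi) * std_normal_density x) \<partial>lborel) = ennreal (sqrt (2 * pi))"
      by simp
    then show ?thesis by (simp only: eq[THEN fun_cong])
  qed
  have nn: "(\<integral>\<^sup>+z. ennreal (HB_weight z) \<partial>lborel) = ennreal (2 * pi)"
  proof -
    have "(\<integral>\<^sup>+z. ennreal (HB_weight z) \<partial>lborel)
        = (\<integral>\<^sup>+z. (\<Prod>b\<in>(Basis::complex set). ennreal (exp (- (z \<bullet> b)\<^sup>2 / 2))) \<partial>lborel)"
      by (intro nn_integral_cong)
        (simp add: Basis_complex_def HB_weight_def cmod_power2 add_divide_distrib
          flip: ennreal_mult' exp_add)
    also have "\<dots> = (\<Prod>b\<in>(Basis::complex set). \<integral>\<^sup>+x. ennreal (exp (- x\<^sup>2 / 2)) \<partial>lborel)"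
      by (rule nn_integral_lborel_prod) auto
    also have "\<dots> = ennreal (2 * pi)"
      unfolding one by (simp add: Basis_complex_def flip: ennreal_mult')
    finally show ?thesis .
  qed
  show "integrable lborel HB_weight"
    by (rule integrableI_nonneg) (auto simp: nn, simp add: HB_weight_def)
  show "(\<integral>z. HB_weight z \<partial>lborel) = 2 * pi"
    by (rule integral_eq_nn_integral[THEN trans]) (auto simp: nn, simp_all add: HB_weight_def)
qed

text \<open>
  Completing the square: the squared modulus of the kernel times the weight is a constant multiple of
  the Gaussian centred at \<open>z\<close>.
\<close>
lemma HB_kernel_in_HB_space: "(\<lambda>w. HB_kernel w z) \<in> HB_space"
proof -
  have eq: "(cmod (HB_kernel w z))\<^sup>2 * HB_weight w =
      ((1 / (2 * pi))\<^sup>2 * exp ((cmod z)\<^sup>2 / 2)) * HB_weight (- z + w)" for w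
  proof -
    have "(cmod (exp (w * cnj z / 2)))\<^sup>2 = exp (Re (w * cnj z))"
      by (simp add: power2_eq_square flip: exp_add)
    moreover have "exp (Re (w * cnj z)) * HB_weight w = exp ((cmod z)\<^sup>2 / 2) * HB_weight (- z + w)"
    proof -
      have "(cmod (- z + w))\<^sup>2 = (cmod w)\<^sup>2 + (cmod z)\<^sup>2 - 2 * Re (w * cnj z)"
        unfolding cmod_power2 by (simp add: power2_eq_square algebra_simps)
      then show ?thesis unfolding HB_weight_def by (simp add: field_simps flip: exp_add)
    qed
    ultimately show ?thesis
      by (simp add: HB_kernel_def norm_mult norm_divide power_mult_distrib power_divide)
  qed
  have "integrable lborel (\<lambda>w. (cmod (HB_kernel w z))\<^sup>2 * HB_weight w)"
    unfolding eq using lborel_translate(1)[OF gaussian_integral_complex(1), of "- z"] by simp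
  then show ?thesis
    by (auto simp: HB_space_def holo_L2_def HB_kernel_def intro!: holomorphic_intros)
qed

text \<open>
  The mean value property at \<open>0\<close> applies to \<open>\<psi>(w) = \<phi>(z + w) exp (- w cnj z / 2)\<close>. The holomorphic
  factor is chosen such that \<open>\<psi>\<close> times the Gaussian centred at \<open>0\<close> is, up to the constant
  \<open>2 \<pi>\<close>, the translate by \<open>z\<close> of \<open>\<phi>\<close> times conjugated kernel times weight.
\<close>
lemma HB_reproducing:
  assumes "\<phi> \<in> HB_space"
  shows "HB_inner \<phi> (\<lambda>w. HB_kernel w z) = \<phi> z"
proof -
  define G where "G = (\<lambda>w. \<phi> w * cnj (HB_kernel w z) * of_real (HB_weight w))"
  define \<psi> where "\<psi> = (\<lambda>w. \<phi> (z + w) * exp (- (w * cnj z / 2)))"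
  have hol: "\<phi> holomorphic_on UNIV" using assms by (simp add: HB_space_def holo_L2_def)
  have \<psi>: "\<psi> holomorphic_on UNIV"
    unfolding \<psi>_def by (intro holomorphic_intros holomorphic_on_compose_gen[OF _ hol, unfolded o_def]) auto
  have G: "integrable lborel G"
    unfolding G_def using assms HB_kernel_in_HB_space[of z]
    by (intro holo_L2_integrable_product) (simp_all add: HB_space_def, simp add: HB_weight_def)
  have eq: "\<psi> w * of_real (HB_weight w) = 2 * pi * G (z + w)" for w
  proof -
    have "exp (- (w * cnj z / 2)) * of_real (HB_weight w) =
        exp (cnj (z + w) * z / 2) * of_real (HB_weight (z + w))"
      unfolding HB_weight_def exp_of_real[symmetric] exp_add[symmetric]
      by (rule arg_cong[where f = exp])
        (simp add: complex_norm_square[of w] complex_norm_square[of "w + z"] field_simps del: of_real_power)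
    then show ?thesis by (simp add: \<psi>_def G_def HB_kernel_def exp_cnj mult_ac)
  qed
  have "(\<integral>w. \<psi> w * of_real (HB_weight w) \<partial>lborel) = \<psi> 0 * of_real (\<integral>w. HB_weight w \<partial>lborel)"
  proof (rule radial_weight_mean_value[OF \<psi>])
    show "integrable lborel (\<lambda>w. \<psi> w * of_real (HB_weight w))"
      unfolding eq using lborel_translate(1)[OF G] by simp
  qed (simp_all add: HB_weight_def norm_mult)
  then have "2 * pi * (\<integral>w. G w \<partial>lborel) = 2 * pi * \<phi> z"
    unfolding eq using lborel_translate(2)[OF G]
    by (simp add: gaussian_integral_complex \<psi>_def)
  then show ?thesis by (simp add: HB_inner_def weighted_inner_def G_def)
qed

section \<open>The isomorphism with the Segal-Bargmann space\<close>

lemma cmod_exp_square: "(cmod (exp (of_real a * z\<^sup>2)))\<^sup>2 = exp (2 * a * Re (z\<^sup>2))"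
  by (simp add: power2_eq_square flip: exp_add)

context
  fixes s :: real
  assumes s: "0 < s" "s < 1"
begin

lemma scale_pos: "0 < (1 - s\<^sup>2) / s" "0 < s / (1 - s\<^sup>2)"
  using s by (simp_all add: power_less_one_iff)

lemma scale_inverse: "sqrt (s / (1 - s\<^sup>2)) * sqrt ((1 - s\<^sup>2) / s) = 1"
proof -
  have "s / (1 - s\<^sup>2) * ((1 - s\<^sup>2) / s) = 1" using scale_pos s by auto
  then show ?thesis by (simp flip: real_sqrt_mult)
qed

lemma scale_inverse_complex:
  "complex_of_real (sqrt (s / (1 - s\<^sup>2))) * (complex_of_real (sqrt ((1 - s\<^sup>2) / s)) * z) = z"
  "complex_of_real (sqrt ((1 - s\<^sup>2) / s)) * (complex_of_real (sqrt (s / (1 - s\<^sup>2))) * z) = z"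
proof -
  have "complex_of_real (sqrt (s / (1 - s\<^sup>2))) * complex_of_real (sqrt ((1 - s\<^sup>2) / s)) = 1"
    by (simp only: of_real_mult[symmetric] scale_inverse of_real_1)
  then show
    "complex_of_real (sqrt (s / (1 - s\<^sup>2))) * (complex_of_real (sqrt ((1 - s\<^sup>2) / s)) * z) = z"
    "complex_of_real (sqrt ((1 - s\<^sup>2) / s)) * (complex_of_real (sqrt (s / (1 - s\<^sup>2))) * z) = z"
    by (metis mult.assoc mult.left_neutral, metis mult.assoc mult.commute mult.left_neutral)
qed

lemma weight_X_to_HB:
  "(cmod (exp (of_real (1 / 4 * ((1 + s\<^sup>2) / (1 - s\<^sup>2))) * z\<^sup>2)))\<^sup>2 * HB_weight z
     = X_weight s (of_real (sqrt (s / (1 - s\<^sup>2))) * z)"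
proof -
  have sq: "(sqrt (s / (1 - s\<^sup>2)))\<^sup>2 = s / (1 - s\<^sup>2)" using scale_pos by simp
  have re: "Re (u\<^sup>2 + (cnj u)\<^sup>2) = 2 * Re (u\<^sup>2)" for u by (simp flip: complex_cnj_power)
  have re_scaled: "Re ((of_real (sqrt (s / (1 - s\<^sup>2))) * z)\<^sup>2) = s / (1 - s\<^sup>2) * Re (z\<^sup>2)"
    unfolding power_mult_distrib of_real_power[symmetric] sq by simp
  have norm_scaled: "(cmod (of_real (sqrt (s / (1 - s\<^sup>2))) * z))\<^sup>2 = s / (1 - s\<^sup>2) * (cmod z)\<^sup>2"
    unfolding norm_mult power_mult_distrib norm_of_real power2_abs sq ..
  define d where "d = 1 - s\<^sup>2"
  have "s \<noteq> 0" "d \<noteq> 0" using s scale_pos by (auto simp: d_def)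
  then show ?thesis
    unfolding cmod_exp_square X_weight_def HB_weight_def exp_add[symmetric] re re_scaled norm_scaled
    unfolding d_def[symmetric]
    by (simp add: field_simps)
qed

lemma weight_HB_to_X:
  "(cmod (exp (- of_real ((1 + s\<^sup>2) / (4 * s)) * z\<^sup>2)))\<^sup>2 * X_weight s z
     = HB_weight (of_real (sqrt ((1 - s\<^sup>2) / s)) * z)"
proof -
  have sq: "(sqrt ((1 - s\<^sup>2) / s))\<^sup>2 = (1 - s\<^sup>2) / s" using scale_pos by simp
  have re: "Re (u\<^sup>2 + (cnj u)\<^sup>2) = 2 * Re (u\<^sup>2)" for u by (simp flip: complex_cnj_power)
  have norm_scaled: "(cmod (of_real (sqrt ((1 - s\<^sup>2) / s)) * z))\<^sup>2 = (1 - s\<^sup>2) / s * (cmod z)\<^sup>2"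
    unfolding norm_mult power_mult_distrib norm_of_real power2_abs sq ..
  show ?thesis
    unfolding of_real_minus[symmetric] cmod_exp_square X_weight_def HB_weight_def
      exp_add[symmetric] re norm_scaled
    using s by (simp add: field_simps)
qed

lemma X_to_HB_in_HB_space: "\<phi> \<in> X_space s \<Longrightarrow> X_to_HB s \<phi> \<in> HB_space"
  unfolding X_to_HB_def X_space_def HB_space_def
  using scale_pos s
  by (intro holo_L2_rescale[where w = "X_weight s"] weight_X_to_HB) (auto intro!: holomorphic_intros)

lemma HB_to_X_in_X_space: "\<psi> \<in> HB_space \<Longrightarrow> HB_to_X s \<psi> \<in> X_space s"
  unfolding HB_to_X_def X_space_def HB_space_def
  using scale_pos s
  by (intro holo_L2_rescale[where w = HB_weight] weight_HB_to_X) (auto intro!: holomorphic_intros)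

lemma X_to_HB_inner:
  assumes "\<phi> \<in> X_space s" "\<psi> \<in> X_space s"
  shows "HB_inner (X_to_HB s \<phi>) (X_to_HB s \<psi>) = X_inner s \<phi> \<psi>"
  unfolding X_to_HB_def HB_inner_def X_inner_def
  using assms scale_pos s
  by (intro weighted_inner_rescale weight_X_to_HB) (auto simp: X_space_def holo_L2_def)

lemma HB_to_X_X_to_HB: "HB_to_X s (X_to_HB s \<phi>) = \<phi>"
proof
  fix z :: complex
  have "1 / 4 * ((1 + s\<^sup>2) / (1 - s\<^sup>2)) * (sqrt ((1 - s\<^sup>2) / s))\<^sup>2 = (1 + s\<^sup>2) / (4 * s)"
    using scale_pos s by (simp add: field_simps)
  then have "exp (of_real (1 / 4 * ((1 + s\<^sup>2) / (1 - s\<^sup>2))) * (of_real (sqrt ((1 - s\<^sup>2) / s)) * z)\<^sup>2)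
      * exp (- of_real ((1 + s\<^sup>2) / (4 * s)) * z\<^sup>2) = 1"
    by (simp only: power_mult_distrib mult.assoc[symmetric] of_real_power[symmetric] of_real_mult[symmetric])
      (simp flip: exp_add)
  then show "HB_to_X s (X_to_HB s \<phi>) z = \<phi> z"
    unfolding HB_to_X_def X_to_HB_def scale_inverse_complex
    using scale_inverse_complex(2)[of "\<phi> z"] by (simp only: mult.assoc mult_1_right)
qed

lemma X_to_HB_HB_to_X: "X_to_HB s (HB_to_X s \<psi>) = \<psi>"
proof
  fix z :: complex
  have "(1 + s\<^sup>2) / (4 * s) * (sqrt (s / (1 - s\<^sup>2)))\<^sup>2 = 1 / 4 * ((1 + s\<^sup>2) / (1 - s\<^sup>2))"
    using scale_pos s by (simp add: field_simps)
  then have "exp (- of_real ((1 + s\<^sup>2) / (4 * s)) * (of_real (sqrt (s / (1 - s\<^sup>2))) * z)\<^sup>2)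
      * exp (of_real (1 / 4 * ((1 + s\<^sup>2) / (1 - s\<^sup>2))) * z\<^sup>2) = 1"
    by (simp only: mult_minus_left power_mult_distrib mult.assoc[symmetric] of_real_power[symmetric] of_real_mult[symmetric])
      (simp flip: exp_add)
  then show "X_to_HB s (HB_to_X s \<psi>) z = \<psi> z"
    unfolding HB_to_X_def X_to_HB_def scale_inverse_complex
    using scale_inverse_complex(1)[of "\<psi> z"] by (simp only: mult.assoc mult_1_right)
qed

lemma X_to_HB_isomorphism:
  "hilbert_isomorphism (X_space s) (X_inner s) HB_space HB_inner (X_to_HB s)"
  unfolding hilbert_isomorphism_def
proof (intro conjI ballI allI)
  show "function_subspace (X_space s)"
    unfolding X_space_def by (intro function_subspace_holo_L2 X_weight_measurable X_weight_nonneg)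
  show "function_subspace HB_space"
    unfolding HB_space_def by (intro function_subspace_holo_L2 HB_weight_measurable HB_weight_nonneg)
  show "bij_betw (X_to_HB s) (X_space s) HB_space"
    by (rule bij_betw_byWitness[where f' = "HB_to_X s"])
      (auto simp: HB_to_X_X_to_HB X_to_HB_HB_to_X X_to_HB_in_HB_space HB_to_X_in_X_space)
  show "X_to_HB s (\<lambda>z. a * f z + b * g z) = (\<lambda>z. a * X_to_HB s f z + b * X_to_HB s g z)" for f g a b
    by (simp add: X_to_HB_def fun_eq_iff algebra_simps)
qed (rule X_to_HB_inner)

lemma inv_X_to_HB:
  assumes "\<psi> \<in> HB_space"
  shows "inv_into (X_space s) (X_to_HB s) \<psi> = HB_to_X s \<psi>"
proof (rule inv_into_f_eq)
  show "inj_on (X_to_HB s) (X_space s)"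
    using X_to_HB_isomorphism by (simp add: hilbert_isomorphism_def bij_betw_def)
qed (simp_all add: assms HB_to_X_in_X_space X_to_HB_HB_to_X)

section \<open>The reproducing kernel\<close>

text \<open>
  In the variable \<open>z\<close> the kernel is a scalar multiple of the image of a Segal-Bargmann kernel
  function. The scalar is the conjugated prefactor that transporting the second variable produces.
\<close>
lemma X_kernel_eq:
  "X_kernel s z \<zeta> = of_real (sqrt ((1 - s\<^sup>2) / s)) * cnj (exp (- of_real ((1 + s\<^sup>2) / (4 * s)) * \<zeta>\<^sup>2))
     * HB_to_X s (\<lambda>w. HB_kernel w (of_real (sqrt ((1 - s\<^sup>2) / s)) * \<zeta>)) z"
proof -
  define k where "k = sqrt ((1 - s\<^sup>2) / s)"
  have k2: "k * k = (1 - s\<^sup>2) / s" using real_sqrt_pow2[OF less_imp_le[OF scale_pos(1)]]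
    by (simp only: k_def power2_eq_square)
  have c: "complex_of_real ((1 - s\<^sup>2) / (2 * pi * s)) = of_real k * of_real k * of_real (1 / (2 * pi))"
    by (simp only: of_real_mult[symmetric] k2) simp
  have e: "complex_of_real ((1 - s\<^sup>2) / (2 * s)) * z * cnj \<zeta> = of_real k * z * cnj (of_real k * \<zeta>) / 2"
  proof -
    have "(1 - s\<^sup>2) / (2 * s) = k * k / 2" by (simp add: k2)
    then show ?thesis by (simp only: of_real_divide of_real_mult) simp
  qed
  define q where "q = complex_of_real ((1 + s\<^sup>2) / (4 * s))"
  have q: "cnj q = q" by (simp add: q_def)
  have "exp (complex_of_real ((1 - s\<^sup>2) / (2 * s)) * z * cnj \<zeta>
          - complex_of_real ((1 + s\<^sup>2) / (4 * s)) * (z\<^sup>2 + (cnj \<zeta>)\<^sup>2)) =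
        cnj (exp (- of_real ((1 + s\<^sup>2) / (4 * s)) * \<zeta>\<^sup>2)) *
          exp (of_real k * z * cnj (of_real k * \<zeta>) / 2) * exp (- of_real ((1 + s\<^sup>2) / (4 * s)) * z\<^sup>2)"
    unfolding e exp_cnj exp_add[symmetric] q_def[symmetric]
    by (rule arg_cong[where f = exp]) (simp add: q algebra_simps)
  then show ?thesis
    unfolding X_kernel_def HB_to_X_def HB_kernel_def k_def[symmetric] c by (simp add: mult_ac)
qed

lemma transport_HB_kernel: "transport_kernel (HB_to_X s) HB_kernel = X_kernel s"
  by (simp add: fun_eq_iff transport_kernel_def X_kernel_eq HB_to_X_def mult_ac)

text \<open>
  With \<open>e\<close> the image of \<open>HB_kernel \<cdot> (k z)\<close>, pairing \<open>\<phi>\<close> with \<open>e\<close> evaluates the transported function at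
  \<open>k z\<close>; the conjugate of the scalar that relates \<open>e\<close> to the kernel function at \<open>z\<close> turns this value into that of
  the inverse transform at \<open>z\<close>.
\<close>
lemma X_kernel_reproducing: "is_reproducing_kernel (X_space s) (X_inner s) (X_kernel s)"
  unfolding is_reproducing_kernel_def
proof (intro conjI allI ballI)
  fix z :: complex
  define k where "k = complex_of_real (sqrt ((1 - s\<^sup>2) / s))"
  define E where "E = (\<lambda>z::complex. exp (- of_real ((1 + s\<^sup>2) / (4 * s)) * z\<^sup>2))"
  define e where "e = HB_to_X s (\<lambda>w. HB_kernel w (k * z))"
  have e: "e \<in> X_space s"
    unfolding e_def by (rule HB_to_X_in_X_space[OF HB_kernel_in_HB_space])
  \<comment> \<open>The zero summand brings the multiple into the form of a linear combination of two vectors.\<close>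
  have K: "(\<lambda>w. X_kernel s w z) = (\<lambda>w. k * cnj (E z) * e w + 0 * e w)"
    by (simp add: X_kernel_eq k_def E_def e_def)
  show "(\<lambda>w. X_kernel s w z) \<in> X_space s"
    unfolding K using X_to_HB_isomorphism e
    unfolding hilbert_isomorphism_def function_subspace_def by blast
  fix \<phi> assume \<phi>: "\<phi> \<in> X_space s"
  have "X_inner s \<phi> (\<lambda>w. X_kernel s w z) = k * E z * X_inner s \<phi> e"
    unfolding K X_inner_def weighted_inner_def
    by (simp add: k_def mult_ac flip: integral_mult_right_zero)
  also have "X_inner s \<phi> e = HB_inner (X_to_HB s \<phi>) (X_to_HB s e)"
    using X_to_HB_inner[OF \<phi> e] by simp
  also have "\<dots> = X_to_HB s \<phi> (k * z)"
    unfolding e_def X_to_HB_HB_to_X by (rule HB_reproducing[OF X_to_HB_in_HB_space[OF \<phi>]])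
  also have "k * E z * X_to_HB s \<phi> (k * z) = HB_to_X s (X_to_HB s \<phi>) z"
    by (simp add: HB_to_X_def k_def E_def mult_ac)
  finally show "\<phi> z = X_inner s \<phi> (\<lambda>w. X_kernel s w z)"
    by (simp add: HB_to_X_X_to_HB)
qed

lemma cnj_X_kernel: "cnj (X_kernel s w z) = X_kernel s z w"
  by (simp add: X_kernel_def exp_cnj mult_ac add.commute)

lemma X_reproducing_integral:
  assumes "\<phi> \<in> X_space s"
  shows "integrable lborel (\<lambda>\<zeta>. X_kernel s z \<zeta> * \<phi> \<zeta> * of_real (X_weight s \<zeta>))"
    and "\<phi> z = (\<integral>\<zeta>. X_kernel s z \<zeta> * \<phi> \<zeta> * of_real (X_weight s \<zeta>) \<partial>lborel)"
proof -
  have eq: "X_kernel s z \<zeta> * \<phi> \<zeta> * of_real (X_weight s \<zeta>)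
      = \<phi> \<zeta> * cnj (X_kernel s \<zeta> z) * of_real (X_weight s \<zeta>)" for \<zeta>
    by (simp add: cnj_X_kernel)
  show "integrable lborel (\<lambda>\<zeta>. X_kernel s z \<zeta> * \<phi> \<zeta> * of_real (X_weight s \<zeta>))"
    unfolding eq using assms X_kernel_reproducing
    by (intro holo_L2_integrable_product X_weight_measurable X_weight_nonneg)
      (simp_all add: X_space_def is_reproducing_kernel_def)
  show "\<phi> z = (\<integral>\<zeta>. X_kernel s z \<zeta> * \<phi> \<zeta> * of_real (X_weight s \<zeta>) \<partial>lborel)"
    unfolding eq using assms X_kernel_reproducing
    by (simp add: is_reproducing_kernel_def X_inner_def weighted_inner_def)
qed

section \<open>Hermite functions\<close>

lemma lambda_coeff_sqrt:
  "lambda_coeff (sqrt s) 0 = of_real (2 * s / (1 - s\<^sup>2))"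
  using s by (simp add: lambda_coeff_def power2_eq_square algebra_simps)

lemma mu_coeff_sqrt: "mu_coeff (sqrt s) 0 = of_real ((1 - s) / (1 + s))"
  using s by (simp add: mu_coeff_def)

text \<open>
  At \<open>(sqrt s, 0)\<close> the dilation by \<open>k\<close> turns the exponent \<open>\<lambda> w\<^sup>2 / 2\<close> into \<open>w\<^sup>2\<close>, so the differentiated
  Gaussian gives a Hermite polynomial, the sign \<open>(- 1) ^ n\<close> and the factor \<open>k ^ n\<close> from the chain rule being
  exactly the prefactor on the left.
\<close>
lemma Psi_fun_scaled:
  "of_real ((- sqrt ((1 - s\<^sup>2) / s)) ^ n) * Psi_fun (sqrt s) 0 n (of_real (sqrt ((1 - s\<^sup>2) / s)) * z)
     = hermite n z * exp (of_real ((1 - s)\<^sup>2 / (4 * s)) * z\<^sup>2)"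
proof -
  define k where "k = sqrt ((1 - s\<^sup>2) / s)"
  define l where "l = lambda_coeff (sqrt s) 0"
  have k2: "k\<^sup>2 = (1 - s\<^sup>2) / s" using scale_pos by (simp add: k_def)
  have lk: "l * (of_real k * w)\<^sup>2 / 2 = w\<^sup>2" for w
  proof -
    have "2 * s / (1 - s\<^sup>2) * k\<^sup>2 = 2" unfolding k2 using s scale_pos by (simp add: field_simps)
    then have "l * of_real (k\<^sup>2) = 2"
      unfolding l_def lambda_coeff_sqrt of_real_mult[symmetric] by simp
    then show ?thesis by (simp add: power_mult_distrib flip: mult.assoc)
  qed
  have mk: "mu_coeff (sqrt s) 0 / 4 * (of_real k * z)\<^sup>2 = of_real ((1 - s)\<^sup>2 / (4 * s)) * z\<^sup>2"
  proof -
    have "1 - s\<^sup>2 = (1 - s) * (1 + s)" by (simp add: power2_eq_square algebra_simps)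
    then have "(1 - s) / (1 + s) / 4 * k\<^sup>2 = (1 - s)\<^sup>2 / (4 * s)"
      unfolding k2 using s by (simp add: divide_simps) (simp add: power2_eq_square)
    then have "mu_coeff (sqrt s) 0 / 4 * of_real (k\<^sup>2) = of_real ((1 - s)\<^sup>2 / (4 * s))"
      unfolding mu_coeff_sqrt by (metis of_real_divide of_real_mult of_real_numeral)
    then show ?thesis by (simp add: power_mult_distrib flip: mult.assoc)
  qed
  have deriv: "of_real k ^ n * (deriv ^^ n) (\<lambda>w. exp (- l * w\<^sup>2 / 2)) (of_real k * z)
      = (deriv ^^ n) (\<lambda>w. exp (- w\<^sup>2)) z"
  proof -
    have "(deriv ^^ n) (\<lambda>w. exp (- l * (of_real k * w)\<^sup>2 / 2)) z
        = of_real k ^ n * (deriv ^^ n) (\<lambda>w. exp (- l * w\<^sup>2 / 2)) (of_real k * z)"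
      by (rule higher_deriv_compose_linear[where S = UNIV and T = UNIV]) (auto intro!: holomorphic_intros)
    then show ?thesis by (simp add: lk)
  qed
  have "Psi_fun (sqrt s) 0 n (of_real k * z) = exp (l * (of_real k * z)\<^sup>2 / 2) *
      (deriv ^^ n) (\<lambda>w. exp (- l * w\<^sup>2 / 2)) (of_real k * z) * Psi_zero (sqrt s) 0 (of_real k * z)"
    by (simp add: Psi_fun_def l_def flip: exp_add)
  note this[unfolded lk]
  moreover have "Psi_zero (sqrt s) 0 (of_real k * z) = exp (of_real ((1 - s)\<^sup>2 / (4 * s)) * z\<^sup>2)"
    by (simp only: Psi_zero_def mk)
  moreover have "complex_of_real ((- k) ^ n) = (- 1) ^ n * of_real k ^ n"
    by (simp flip: power_mult_distrib)
  ultimately show ?thesis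
    unfolding hermite_def deriv[symmetric] k_def[symmetric] by (simp only: mult_ac)
qed

text \<open>
  What remains is to collect the quadratic exponents:
  \<open>(1 + s\<^sup>2) / (4 s) - 1 / 2 = (1 - s)\<^sup>2 / (4 s)\<close>.
\<close>
lemma psi_fun_eq_Psi_fun:
  "psi_fun s n z *
     exp (- complex_of_real ((1 - s\<^sup>2) / (4 * s) * (cmod z)\<^sup>2)
          + complex_of_real ((1 + s\<^sup>2) / (4 * s)) * z\<^sup>2)
   = complex_of_real ((- sqrt ((1 - s\<^sup>2) / s)) ^ n * b_coeff n s powr (- 1 / 2)) *
     Psi_fun (sqrt s) 0 n (complex_of_real (sqrt ((1 - s\<^sup>2) / s)) * z) *
     exp (- complex_of_real (1 / 4 * (cmod (complex_of_real (sqrt ((1 - s\<^sup>2) / s)) * z))\<^sup>2))"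
proof -
  define b where "b = complex_of_real (b_coeff n s powr (- 1 / 2))"
  define D where "D = - complex_of_real ((1 - s\<^sup>2) / (4 * s) * (cmod z)\<^sup>2)"
  have gauss: "- complex_of_real (1 / 4 * (cmod (complex_of_real (sqrt ((1 - s\<^sup>2) / s)) * z))\<^sup>2) = D"
    using scale_pos unfolding D_def norm_mult power_mult_distrib norm_of_real power2_abs by simp
  have "(1 + s\<^sup>2) / (4 * s) = 1 / 2 + (1 - s)\<^sup>2 / (4 * s)"
    using s by (simp add: field_simps power2_eq_square)
  then have "complex_of_real ((1 + s\<^sup>2) / (4 * s)) = 1 / 2 + of_real ((1 - s)\<^sup>2 / (4 * s))"
    by (simp only: of_real_add of_real_divide of_real_1 of_real_numeral)
  then have "exp (- z\<^sup>2 / 2) * exp (D + complex_of_real ((1 + s\<^sup>2) / (4 * s)) * z\<^sup>2)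
      = exp (of_real ((1 - s)\<^sup>2 / (4 * s)) * z\<^sup>2) * exp D"
    by (simp only: exp_add[symmetric]) (simp add: algebra_simps)
  then have "psi_fun s n z * exp (D + complex_of_real ((1 + s\<^sup>2) / (4 * s)) * z\<^sup>2)
      = b * (hermite n z * exp (of_real ((1 - s)\<^sup>2 / (4 * s)) * z\<^sup>2)) * exp D"
    unfolding psi_fun_def b_def[symmetric] by (simp add: mult_ac)
  then show ?thesis
    unfolding gauss D_def[symmetric]
    unfolding Psi_fun_scaled[symmetric] of_real_mult b_def[symmetric]
    by (simp only: mult_ac)
qed

end

theorem theorem3:
  fixes s :: real
  assumes "0 < s" and "s < 1"
  shows
    "(hilbert_isomorphism (X_space s) (X_inner s) HB_space HB_inner (X_to_HB s) \<and>
      (\<forall>\<psi>\<in>HB_space. inv_into (X_space s) (X_to_HB s) \<psi> = HB_to_X s \<psi>))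
   \<and> (\<forall>(n::nat) (z::complex).
        psi_fun s n z *
          exp (- complex_of_real ((1 - s\<^sup>2) / (4 * s) * (cmod z)\<^sup>2)
               + complex_of_real ((1 + s\<^sup>2) / (4 * s)) * z\<^sup>2)
        = complex_of_real ((- sqrt ((1 - s\<^sup>2) / s)) ^ n * b_coeff n s powr (- 1 / 2)) *
          Psi_fun (sqrt s) 0 n (complex_of_real (sqrt ((1 - s\<^sup>2) / s)) * z) *
          exp (- complex_of_real (1 / 4 * (cmod (complex_of_real (sqrt ((1 - s\<^sup>2) / s)) * z))\<^sup>2)))
   \<and> (transport_kernel (HB_to_X s) HB_kernel = X_kernel s \<and>
      is_reproducing_kernel (X_space s) (X_inner s) (X_kernel s) \<and>
      (\<forall>\<phi>\<in>X_space s. \<forall>z.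
         integrable lborel (\<lambda>\<zeta>. X_kernel s z \<zeta> * \<phi> \<zeta> * complex_of_real (X_weight s \<zeta>)) \<and>
         \<phi> z = (\<integral>\<zeta>. X_kernel s z \<zeta> * \<phi> \<zeta> * complex_of_real (X_weight s \<zeta>) \<partial>lborel)))"
proof (intro conjI allI ballI)
qed (erule inv_X_to_HB[OF assms] X_reproducing_integral[OF assms] |
  rule X_to_HB_isomorphism[OF assms] psi_fun_eq_Psi_fun[OF assms] transport_HB_kernel[OF assms]
    X_kernel_reproducing[OF assms])+

end
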